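(* For every integer $n\ge 4$, the maximum forcing number of the hypercube $Q_n$ satisfies $F(Q_n)\le\left\lfloor\frac{n2^{n-1}-5\cdot 2^{n-3}}{n}\right\rfloor$.
   Context: The hypercube graph $Q_n$ has vertex set $\{0,1\}^n$, two vertices being adjacent iff they differ in exactly one coordinate. A perfect matching of a graph $G$ is a set $M\subseteq E(G)$ such that every vertex lies in exactly one edge of $M$. A subset $S\subseteq M$ is a forcing set for $M$ if $M$ is the unique perfect matching of $G$ containing $S$. The forcing number of $M$ is $f(G,M)=\min\{|S|: S\text{ is a forcing set for }M\}$, and the maximum forcing number of $G$ is $F(G)=\max\{f(G,M): M\text{ is a perfect matching of }G\}$. *)

theory Defs
  imports Complex_Main "HOL-Library.FuncSet"
begin

text \<open>Undirected graphs; an edge is the set of its end vertices.\<close>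

record 'a graph =
  verts :: "'a set"
  edges :: "'a set set"

definition perfect_matching :: "'a graph \<Rightarrow> 'a set set \<Rightarrow> bool" where
  "perfect_matching G M \<longleftrightarrow>
     M \<subseteq> edges G \<and> (\<forall>v \<in> verts G. \<exists>!e. e \<in> M \<and> v \<in> e)"

definition forcing_set :: "'a graph \<Rightarrow> 'a set set \<Rightarrow> 'a set set \<Rightarrow> bool" where
  "forcing_set G M S \<longleftrightarrow>
     S \<subseteq> M \<and> perfect_matching G M \<and>
     (\<forall>M'. perfect_matching G M' \<and> S \<subseteq> M' \<longrightarrow> M' = M)"

text \<open>The minimum and the maximum below are meaningful for a graph with finitely many edges,
  each of them a nonempty set of vertices: the sets are then finite, the first is nonempty
  whenever \<open>M\<close> is a perfect matching (which forces itself), and the second whenever \<open>G\<close> has a perfect matching.\<close>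

definition forcing_number :: "'a graph \<Rightarrow> 'a set set \<Rightarrow> nat" where
  "forcing_number G M = Min {card S | S. forcing_set G M S}"

definition max_forcing_number :: "'a graph \<Rightarrow> nat" where
  "max_forcing_number G = Max {forcing_number G M | M. perfect_matching G M}"

text \<open>A vector in \<open>{0,1}\<^sup>n\<close> is an extensional function on the index set \<open>{..<n}\<close>,
  so that distinct functions are distinct vectors.\<close>

definition hypercube :: "nat \<Rightarrow> (nat \<Rightarrow> nat) graph" where
  "hypercube n =
     (let V = {..<n} \<rightarrow>\<^sub>E {0, 1} in
      \<lparr> verts = V,
        edges = {{x, y} | x y. x \<in> V \<and> y \<in> V \<and> card {i \<in> {..<n}. x i \<noteq> y i} = 1} \<rparr>)"

lemma edge_of_hypercube:
  assumes "e \<in> edges (hypercube n)"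
  shows "e \<noteq> {} \<and> e \<subseteq> verts (hypercube n)"
proof -
  let ?V = "{..<n} \<rightarrow>\<^sub>E {0, 1::nat}"
  have "\<exists>x y. e = {x, y} \<and> x \<in> ?V \<and> y \<in> ?V \<and> card {i \<in> {..<n}. x i \<noteq> y i} = 1"
    using assms unfolding hypercube_def Let_def graph.simps by (rule CollectD)
  then obtain x y where "e = {x, y}" "x \<in> ?V" "y \<in> ?V"
    by blast
  moreover have "verts (hypercube n) = ?V"
    by (simp only: hypercube_def Let_def graph.simps)
  ultimately show ?thesis
    by blast
qed

lemma finite_edges_hypercube: "finite (edges (hypercube n))"
proof (rule finite_subset)
  show "edges (hypercube n) \<subseteq> Pow (verts (hypercube n))"
    using edge_of_hypercube by blast
  have "finite ({..<n} \<rightarrow>\<^sub>E {0, 1::nat})"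
    by (intro finite_PiE) simp_all
  then show "finite (Pow (verts (hypercube n)))"
    by (simp only: hypercube_def Let_def graph.simps finite_Pow_iff)
qed

lemma finite_forcing_sizes:
  assumes "finite (edges G)"
  shows "finite {card S | S. forcing_set G M S}"
proof -
  have "{card S | S. forcing_set G M S} \<subseteq> card ` Pow (edges G)"
    by (auto simp: forcing_set_def perfect_matching_def)
  then show ?thesis
    using assms by (meson finite_Pow_iff finite_imageI finite_subset)
qed

lemma forcing_set_self:
  assumes M: "perfect_matching G M"
    and G: "\<And>e. e \<in> edges G \<Longrightarrow> e \<noteq> {} \<and> e \<subseteq> verts G"
  shows "forcing_set G M M"
proof -
  have "M' \<subseteq> M" if M': "perfect_matching G M'" and sub: "M \<subseteq> M'" for M'
  proof
    fix e assume e: "e \<in> M'"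
    then have "e \<in> edges G"
      using M' by (auto simp: perfect_matching_def)
    then obtain v where v: "v \<in> e" "v \<in> verts G"
      using G by blast
    then obtain e' where e': "e' \<in> M" "v \<in> e'"
      using M unfolding perfect_matching_def by blast
    have "e = e'"
      using M' e e' v sub unfolding perfect_matching_def by blast
    then show "e \<in> M"
      using e' by simp
  qed
  then show ?thesis
    using M unfolding forcing_set_def by blast
qed

lemma finite_forcing_numbers:
  assumes "finite (edges G)"
  shows "finite {forcing_number G M | M. perfect_matching G M}"
proof -
  have "{forcing_number G M | M. perfect_matching G M} \<subseteq> forcing_number G ` Pow (edges G)"
    by (auto simp: perfect_matching_def)
  then show ?thesis
    using assms by (meson finite_Pow_iff finite_imageI finite_subset)
qed

lemma ex_perfect_matching_hypercube:
  assumes "n \<ge> 1"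
  shows "\<exists>M. perfect_matching (hypercube n) M"
proof -
  let ?V = "{..<n} \<rightarrow>\<^sub>E {0, 1::nat}"
  define p where "p x = {x(0 := 0), x(0 := 1)}" for x :: "nat \<Rightarrow> nat"
  have edge: "p x \<in> edges (hypercube n)" if x: "x \<in> ?V" for x
  proof -
    have "{i \<in> {..<n}. (x(0 := 0)) i \<noteq> (x(0 := 1)) i} = {0}"
      using assms by auto
    then have "card {i \<in> {..<n}. (x(0 := 0)) i \<noteq> (x(0 := 1)) i} = 1"
      by simp
    moreover have "x(0 := 0) \<in> ?V" "x(0 := 1) \<in> ?V"
      using x assms by (auto simp: PiE_iff extensional_def)
    ultimately have "\<exists>a b. p x = {a, b} \<and> a \<in> ?V \<and> b \<in> ?V \<and> card {i \<in> {..<n}. a i \<noteq> b i} = 1"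
      unfolding p_def by blast
    then show ?thesis
      unfolding hypercube_def Let_def graph.simps by (rule CollectI)
  qed
  have self: "x \<in> p x" if x: "x \<in> ?V" for x
  proof -
    have "x 0 = 0 \<or> x 0 = 1"
      using PiE_mem[OF x, of 0] assms by simp
    then have "x = x(0 := 0) \<or> x = x(0 := 1)"
      by (metis fun_upd_triv)
    then show ?thesis
      unfolding p_def by blast
  qed
  have same: "p y = p x" if "x \<in> p y" for x y
  proof -
    have "x = y(0 := 0) \<or> x = y(0 := 1)"
      using that by (simp add: p_def)
    then have "x(0 := 0) = y(0 := 0)" "x(0 := 1) = y(0 := 1)"
      by (elim disjE; simp)+
    then show ?thesis
      by (simp only: p_def)
  qed
  have "perfect_matching (hypercube n) (p ` ?V)"
    unfolding perfect_matching_def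
  proof (intro conjI ballI)
    show "p ` ?V \<subseteq> edges (hypercube n)"
      using edge by blast
    fix v assume "v \<in> verts (hypercube n)"
    then have v: "v \<in> ?V"
      by (simp only: hypercube_def Let_def graph.simps)
    show "\<exists>!e. e \<in> p ` ?V \<and> v \<in> e"
    proof (rule ex1I[of _ "p v"])
      show "p v \<in> p ` ?V \<and> v \<in> p v"
        using self v by blast
    next
      fix e assume "e \<in> p ` ?V \<and> v \<in> e"
      then show "e = p v"
        using same by blast
    qed
  qed
  then show ?thesis
    by blast
qed

end

theory Submission
  imports Defs
begin

text \<open>
  Fix a perfect matching \<open>M\<close> of a bipartite graph with sides \<open>A\<close> and \<open>B\<close>, and write it as
  the edges \<open>{a, p a}\<close> for a bijection \<open>p\<close> from \<open>A\<close> to \<open>B\<close>. Contracting the edges of \<open>M\<close> gives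
  a digraph on \<open>A\<close>, with an arc from \<open>a\<close> to \<open>a' \<noteq> a\<close> whenever \<open>a\<close> is adjacent to \<open>p a'\<close>. Directed
  cycles of this digraph are the \<open>M\<close>-alternating cycles of the graph, so the complement in \<open>M\<close> of
  a set of edges forces \<open>M\<close> as soon as the corresponding vertices in \<open>A\<close> span no directed
  cycle (\<open>forcing_set_of_acyclic_on\<close>). So a large acyclic set gives a small forcing set.

  Let \<open>T\<close> be an acyclic set of maximum size in a digraph with all in-degrees less than \<open>d\<close>. Every
  vertex outside \<open>T\<close> has an out-neighbour in \<open>T\<close>, for otherwise it could be added. If
  two outside vertices \<open>x\<close> and \<open>y\<close> had the same \<open>t\<close> as their only out-neighbour in \<open>T\<close>, then
  replacing \<open>t\<close> by \<open>x\<close> and \<open>y\<close> would enlarge \<open>T\<close>, unless both arcs between \<open>x\<close> and \<open>y\<close> exist. In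
  that exceptional case \<open>x\<close> and \<open>y\<close> have the three common neighbours \<open>p x\<close>, \<open>p y\<close> and \<open>p t\<close> in
  the graph, which cannot happen in a hypercube, where two distinct vertices have at most two. So at
  most \<open>card T\<close> outside vertices have a single out-neighbour in \<open>T\<close> and the others have at least
  two. Counting the arcs into \<open>T\<close> gives \<open>2 * card A \<le> (d + 2) * card T\<close>
  (\<open>ex_large_acyclic_set\<close>).

  For the hypercube, \<open>d = n\<close> and \<open>card A = 2 ^ (n - 1)\<close>, so every perfect matching
  has forcing number at most \<open>n * 2 ^ (n - 1) / (n + 2)\<close>. For \<open>n \<ge> 4\<close> this implies the
  bound of the final theorem, because \<open>4 * n ^ 2 \<le> (n + 2) * (4 * n - 5)\<close>.
\<close>

section \<open>Acyclic sets in digraphs\<close>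

text \<open>
  For finite \<open>T\<close> this says that \<open>E\<close> has no directed cycle inside \<open>T\<close>. The form with a sink in every
  nonempty subset makes it unnecessary to handle paths or cycles.
\<close>

definition acyclic_on :: "('a \<Rightarrow> 'a \<Rightarrow> bool) \<Rightarrow> 'a set \<Rightarrow> bool" where
  "acyclic_on E T \<longleftrightarrow> (\<forall>U \<subseteq> T. U \<noteq> {} \<longrightarrow> (\<exists>u\<in>U. \<forall>w\<in>U. \<not> E u w))"

lemma acyclic_on_subset:
  assumes "acyclic_on E T" "U \<subseteq> T"
  shows "acyclic_on E U"
  using assms unfolding acyclic_on_def by (meson order_trans)

text \<open>
  The new vertex is a sink of every subset that contains it, and all other subsets lie in \<open>T\<close>.
\<close>

lemma acyclic_on_insert:
  assumes "acyclic_on E T" "\<And>t. t \<in> insert x T \<Longrightarrow> \<not> E x t"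
  shows "acyclic_on E (insert x T)"
  unfolding acyclic_on_def
proof (intro allI impI)
  fix U assume U: "U \<subseteq> insert x T" "U \<noteq> {}"
  show "\<exists>u\<in>U. \<forall>w\<in>U. \<not> E u w"
  proof (cases "x \<in> U")
    case True
    then show ?thesis using U assms(2) by blast
  next
    case False
    then have "U \<subseteq> T" using U by blast
    then show ?thesis using U assms(1) unfolding acyclic_on_def by blast
  qed
qed

text \<open>
  A maximum acyclic set \<open>T\<close> works: by the exchange argument, each \<open>t\<close> in \<open>T\<close> is the only
  out-neighbour in \<open>T\<close> of at most one outside vertex, so all outside vertices
  except at most \<open>card T\<close> contribute at least two arcs into \<open>T\<close>, whereas the in-degrees limit the number of these arcs
  to \<open>(d - 1) * card T\<close>.
\<close>

lemma ex_large_acyclic_set: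
  fixes E :: "'a \<Rightarrow> 'a \<Rightarrow> bool"
  assumes fin: "finite V"
    and irrefl: "\<And>x. x \<in> V \<Longrightarrow> \<not> E x x"
    and indegree: "\<And>t. t \<in> V \<Longrightarrow> card {x \<in> V. E x t} < d"
    and no_common: "\<And>x y t. \<lbrakk>x \<in> V; y \<in> V; t \<in> V; E x y; E y x; E x t\<rbrakk> \<Longrightarrow> \<not> E y t"
  shows "\<exists>T \<subseteq> V. acyclic_on E T \<and> 2 * card V \<le> (d + 2) * card T"
proof -
  have "acyclic_on E {} \<and> {} \<subseteq> V"
    by (simp add: acyclic_on_def)
  moreover have "\<forall>T. acyclic_on E T \<and> T \<subseteq> V \<longrightarrow> card T < Suc (card V)"
    using fin by (simp add: card_mono less_Suc_eq_le)
  ultimately obtain T where T: "acyclic_on E T" "T \<subseteq> V"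
    and max: "\<And>T'. acyclic_on E T' \<Longrightarrow> T' \<subseteq> V \<Longrightarrow> card T' \<le> card T"
    using ex_has_greatest_nat[of "\<lambda>T. acyclic_on E T \<and> T \<subseteq> V" "{}" card "Suc (card V)"]
    by (metis less_imp_le)
  have finT: "finite T"
    using T fin finite_subset by blast
  define out where "out x = {t \<in> T. E x t}" for x
  have fin_out: "finite (out x)" for x
    using finT by (simp add: out_def)
  define W where "W = V - T"
  have finW: "finite W"
    using fin by (simp add: W_def)
  define W1 where "W1 = {x \<in> W. card (out x) = 1}"
  have out_pos: "card (out x) \<ge> 1" if x: "x \<in> W" for x
  proof (rule ccontr)
    assume "\<not> card (out x) \<ge> 1"
    then have "out x = {}"
      using fin_out by (simp add: not_le)
    then have "acyclic_on E (insert x T)"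
      using T x irrefl by (intro acyclic_on_insert) (auto simp: out_def W_def)
    then have "card (insert x T) \<le> card T"
      using T x by (intro max) (auto simp: W_def)
    then show False
      using x finT by (simp add: W_def)
  qed
  have unique: "x = y" if x: "x \<in> W" "out x = {t}" and y: "y \<in> W" "out y = {t}" for x y t
  proof (rule ccontr)
    assume neq: "x \<noteq> y"
    have t: "t \<in> T" "E x t" "E y t"
      using x y by (auto simp: out_def)
    \<comment> \<open>Without the arc from \<open>b\<close> to \<open>a\<close>, first \<open>a\<close> and then \<open>b\<close> can replace \<open>t\<close>.\<close>
    have swap: "E b a" if a: "a \<in> W" "out a = {t}" and b: "b \<in> W" "out b = {t}" and "a \<noteq> b" for a b
    proof (rule ccontr)
      assume nE: "\<not> E b a"
      have "acyclic_on E (insert a (T - {t}))"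
        using a irrefl by (intro acyclic_on_insert acyclic_on_subset[OF T(1)])
          (auto simp: out_def W_def)
      then have "acyclic_on E (insert b (insert a (T - {t})))"
        using b irrefl nE by (intro acyclic_on_insert[of E "insert a (T - {t})"]) (auto simp: out_def W_def)
      then have "card (insert b (insert a (T - {t}))) \<le> card T"
        using T a b by (intro max) (auto simp: W_def)
      moreover have "card (insert b (insert a (T - {t}))) = Suc (card T)"
        using a b \<open>a \<noteq> b\<close> finT t card_Suc_Diff1[OF finT t(1)] by (simp add: W_def)
      ultimately show False
        by simp
    qed
    have "E x y" "E y x"
      using swap x y neq by blast+
    then show False
      using no_common[of x y t] t x y T by (auto simp: W_def)
  qed
  have "card W1 \<le> card T"
  proof (rule card_inj_on_le)
    show "inj_on (\<lambda>x. the_elem (out x)) W1"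
    proof (rule inj_onI)
      fix x y assume "x \<in> W1" "y \<in> W1" "the_elem (out x) = the_elem (out y)"
      then show "x = y"
        using unique by (auto simp: W1_def card_1_singleton_iff)
    qed
    show "(\<lambda>x. the_elem (out x)) ` W1 \<subseteq> T"
    proof
      fix s assume "s \<in> (\<lambda>x. the_elem (out x)) ` W1"
      then obtain x where "out x = {s}"
        by (auto simp: W1_def card_1_singleton_iff)
      then show "s \<in> T"
        by (auto simp: out_def)
    qed
  qed (rule finT)
  moreover have "2 * card W \<le> (\<Sum>x\<in>W. card (out x)) + card W1"
  proof -
    have W1: "card W1 = (\<Sum>x\<in>W. if card (out x) = 1 then 1 else 0)"
      unfolding W1_def card_eq_sum using finW by (rule sum.inter_filter)
    have "2 * card W = (\<Sum>x\<in>W. 2)"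
      by simp
    also have "\<dots> \<le> (\<Sum>x\<in>W. card (out x) + (if card (out x) = 1 then 1 else 0))"
      using out_pos by (intro sum_mono) fastforce
    also have "\<dots> = (\<Sum>x\<in>W. card (out x)) + card W1"
      by (simp only: W1 sum.distrib)
    finally show ?thesis .
  qed
  moreover have "(\<Sum>x\<in>W. card (out x)) + card T \<le> d * card T"
  proof -
    have "(\<Sum>x\<in>W. card (out x)) = (\<Sum>t\<in>T. card {x \<in> W. E x t})"
      unfolding out_def using finW finT by (intro sum_multicount_gen ballI refl)
    then have "(\<Sum>x\<in>W. card (out x)) + card T = (\<Sum>t\<in>T. card {x \<in> W. E x t} + 1)"
      by (simp only: sum.distrib card_eq_sum)
    also have "\<dots> \<le> (\<Sum>t\<in>T. d)"
    proof (rule sum_mono)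
      fix t assume "t \<in> T"
      then have "card {x \<in> V. E x t} < d"
        using T indegree by blast
      moreover have "card {x \<in> W. E x t} \<le> card {x \<in> V. E x t}"
        using fin by (intro card_mono) (auto simp: W_def)
      ultimately show "card {x \<in> W. E x t} + 1 \<le> d"
        by simp
    qed
    finally show ?thesis
      by (simp add: mult.commute)
  qed
  moreover have "card V = card W + card T"
    using T fin finT by (simp add: W_def card_Diff_subset card_mono)
  ultimately have "2 * card V \<le> (d + 2) * card T"
    by (simp add: algebra_simps)
  then show ?thesis
    using T by blast
qed

section \<open>Bipartite graphs\<close>

lemma bipartite_perfect_matching_bij:
  assumes parts: "verts G = A \<union> B" "A \<inter> B = {}"
    and bip: "\<And>e. e \<in> edges G \<Longrightarrow> \<exists>a\<in>A. \<exists>b\<in>B. e = {a, b}"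
    and M: "perfect_matching G M"
  obtains p where "bij_betw p A B" "M = (\<lambda>a. {a, p a}) ` A"
proof -
  have ME: "\<exists>a\<in>A. \<exists>b\<in>B. e = {a, b}" if "e \<in> M" for e
    using that M bip by (auto simp: perfect_matching_def)
  have uniq: "e = e'" if "e \<in> M" "e' \<in> M" "v \<in> e" "v \<in> e'" for e e' v
  proof -
    have "v \<in> verts G"
      using ME[OF that(1)] that(3) parts by auto
    then show ?thesis
      using M that unfolding perfect_matching_def by blast
  qed
  have cover: "\<exists>e\<in>M. v \<in> e" if "v \<in> A \<union> B" for v
    using M that parts unfolding perfect_matching_def by blast
  have "\<exists>b\<in>B. {a, b} \<in> M" if a: "a \<in> A" for a
  proof -
    obtain e where e: "e \<in> M" "a \<in> e"
      using cover a by blast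
    obtain a' b where "a' \<in> A" "b \<in> B" "e = {a', b}"
      using ME e by blast
    then show ?thesis
      using e a parts by auto
  qed
  then obtain p where p: "\<And>a. a \<in> A \<Longrightarrow> p a \<in> B \<and> {a, p a} \<in> M"
    by metis
  have eq: "{a, p a} = e" if "a \<in> A" "e \<in> M" "a \<in> e" for a e
    using uniq[of "{a, p a}" e a] that p by auto
  have "inj_on p A"
  proof (rule inj_onI)
    fix a a' assume a: "a \<in> A" "a' \<in> A" "p a = p a'"
    have "{a, p a} = {a', p a'}"
      by (rule uniq[of _ _ "p a"]) (use p a in \<open>blast, blast, simp_all\<close>)
    moreover have "a \<noteq> p a'"
      using a p parts by blast
    ultimately show "a = a'"
      by (auto simp: doubleton_eq_iff)
  qed
  moreover have "p ` A = B"
  proof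
    show "p ` A \<subseteq> B"
      using p by blast
    show "B \<subseteq> p ` A"
    proof
      fix b assume b: "b \<in> B"
      obtain e where e: "e \<in> M" "b \<in> e"
        using cover b by blast
      obtain a b' where ab: "a \<in> A" "b' \<in> B" "e = {a, b'}"
        using ME e by blast
      then have "b = b'" "{a, p a} = {a, b'}"
        using e b parts eq by auto
      then show "b \<in> p ` A"
        using ab by (auto simp: doubleton_eq_iff)
    qed
  qed
  moreover have "M = (\<lambda>a. {a, p a}) ` A"
  proof
    show "M \<subseteq> (\<lambda>a. {a, p a}) ` A"
    proof
      fix e assume e: "e \<in> M"
      then obtain a where "a \<in> A" "a \<in> e"
        using ME by blast
      then show "e \<in> (\<lambda>a. {a, p a}) ` A"
        using e eq by blast
    qed
    show "(\<lambda>a. {a, p a}) ` A \<subseteq> M"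
      using p by blast
  qed
  ultimately show ?thesis
    using that by (simp add: bij_betw_def)
qed

text \<open>
  Let \<open>M'\<close> be another perfect matching that contains the given edges, encoded by a bijection \<open>q\<close>.
  Where \<open>q\<close> and \<open>p\<close> differ at \<open>u\<close>, they also differ at the vertex \<open>w\<close> with \<open>p w = q u\<close>, and there
  is an arc from \<open>u\<close> to \<open>w\<close>. So the set of places where they differ lies in \<open>T\<close> and
  has no sink, which acyclicity allows only for the empty set.
\<close>

lemma forcing_set_of_acyclic_on:
  fixes p :: "'a \<Rightarrow> 'a"
  assumes parts: "verts G = A \<union> B" "A \<inter> B = {}"
    and bip: "\<And>e. e \<in> edges G \<Longrightarrow> \<exists>a\<in>A. \<exists>b\<in>B. e = {a, b}"
    and M: "perfect_matching G M"
    and p: "bij_betw p A B" "M = (\<lambda>a. {a, p a}) ` A"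
    and T: "T \<subseteq> A" "acyclic_on (\<lambda>a a'. a \<noteq> a' \<and> {a, p a'} \<in> edges G) T"
  shows "forcing_set G M ((\<lambda>a. {a, p a}) ` (A - T))"
  unfolding forcing_set_def
proof (intro conjI allI impI)
  show "(\<lambda>a. {a, p a}) ` (A - T) \<subseteq> M"
    using p by blast
  show "perfect_matching G M"
    by (rule M)
  fix M' assume "perfect_matching G M' \<and> (\<lambda>a. {a, p a}) ` (A - T) \<subseteq> M'"
  then have M': "perfect_matching G M'" and sub: "\<And>a. a \<in> A - T \<Longrightarrow> {a, p a} \<in> M'"
    by auto
  obtain q where q: "bij_betw q A B" "M' = (\<lambda>a. {a, q a}) ` A"
    using bipartite_perfect_matching_bij[OF parts bip M'] by blast
  have mem: "p a \<in> B" "q a \<in> B" if "a \<in> A" for a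
    using that p q by (auto simp: bij_betw_def)
  have fixed: "q a = p a" if a: "a \<in> A - T" for a
  proof -
    obtain a' where a': "a' \<in> A" "{a, p a} = {a', q a'}"
      using sub[OF a] q by blast
    then show ?thesis
      using a mem parts by (auto simp: doubleton_eq_iff)
  qed
  define U where "U = {a \<in> T. q a \<noteq> p a}"
  have "U = {}"
  proof (rule ccontr)
    assume "U \<noteq> {}"
    moreover have "U \<subseteq> T"
      by (auto simp: U_def)
    ultimately have "\<exists>u\<in>U. \<forall>w\<in>U. \<not> (u \<noteq> w \<and> {u, p w} \<in> edges G)"
      by (rule T(2)[unfolded acyclic_on_def, rule_format, rotated])
    then obtain u where u: "u \<in> U"
      and sink: "\<And>w. w \<in> U \<Longrightarrow> \<not> (u \<noteq> w \<and> {u, p w} \<in> edges G)"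
      by (elim bexE) simp
    have uA: "u \<in> A" "q u \<noteq> p u"
      using u T by (auto simp: U_def)
    then obtain w where w: "w \<in> A" "p w = q u"
      using mem p by (metis bij_betw_imp_surj_on imageE)
    have "w \<noteq> u"
      using w uA by auto
    then have "q w \<noteq> p w"
      using w uA q by (metis bij_betw_imp_inj_on inj_onD)
    then have "w \<in> U"
      using fixed[of w] w by (auto simp: U_def)
    moreover have "{u, p w} \<in> edges G"
      using w uA q M' by (auto simp: perfect_matching_def)
    ultimately show False
      using sink \<open>w \<noteq> u\<close> by blast
  qed
  then have "q a = p a" if "a \<in> A" for a
    using that fixed by (auto simp: U_def)
  then show "M' = M"
    unfolding p q by (intro image_cong) auto
qed

text \<open>
  The in-degrees in the contracted digraph are less than \<open>d\<close>, since among the neighbours of \<open>p t\<close>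
  the vertex \<open>t\<close> itself gives no arc. The bound on common neighbours excludes a pair \<open>x\<close>, \<open>y\<close> with
  arcs in both directions and a common out-neighbour.
\<close>

theorem forcing_number_bipartite_le:
  assumes fin: "finite (verts G)"
    and parts: "verts G = A \<union> B" "A \<inter> B = {}"
    and bip: "\<And>e. e \<in> edges G \<Longrightarrow> \<exists>a\<in>A. \<exists>b\<in>B. e = {a, b}"
    and degree: "\<And>b. b \<in> B \<Longrightarrow> card {a. {a, b} \<in> edges G} \<le> d"
    and no_K23: "\<And>x y. \<lbrakk>x \<in> A; y \<in> A; x \<noteq> y\<rbrakk> \<Longrightarrow>
       card {b. {x, b} \<in> edges G \<and> {y, b} \<in> edges G} \<le> 2"
    and M: "perfect_matching G M"
  shows "2 * (d + 2) * forcing_number G M \<le> d * card (verts G)"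
proof -
  have edge_verts: "e \<subseteq> verts G" if "e \<in> edges G" for e
    using bip[OF that] parts by auto
  have finA: "finite A" and finB: "finite B"
    using fin parts by auto
  obtain p where p: "bij_betw p A B" "M = (\<lambda>a. {a, p a}) ` A"
    using bipartite_perfect_matching_bij[OF parts bip M] by blast
  have pB: "p a \<in> B" if "a \<in> A" for a
    using that p by (auto simp: bij_betw_def)
  have pE: "{a, p a} \<in> edges G" if "a \<in> A" for a
    using that p M by (auto simp: perfect_matching_def)
  define E where "E = (\<lambda>a a'. a \<noteq> a' \<and> {a, p a'} \<in> edges G)"
  have "\<exists>T \<subseteq> A. acyclic_on E T \<and> 2 * card A \<le> (d + 2) * card T"
  proof (rule ex_large_acyclic_set[OF finA])
    show "\<not> E x x" for x
      by (simp add: E_def)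
  next
    fix t assume t: "t \<in> A"
    have "{x \<in> A. E x t} \<subset> {a. {a, p t} \<in> edges G}"
      using t pE by (auto simp: E_def)
    moreover have "finite {a. {a, p t} \<in> edges G}"
      by (rule finite_subset[OF _ fin]) (use edge_verts in auto)
    ultimately have "card {x \<in> A. E x t} < card {a. {a, p t} \<in> edges G}"
      by (intro psubset_card_mono)
    also have "\<dots> \<le> d"
      using degree t pB by blast
    finally show "card {x \<in> A. E x t} < d" .
  next
    fix x y t assume A: "x \<in> A" "y \<in> A" "t \<in> A" and xy: "E x y" "E y x" and xt: "E x t"
    show "\<not> E y t"
    proof
      assume yt: "E y t"
      have neq: "x \<noteq> y" "t \<noteq> x" "t \<noteq> y"
        using xy xt yt by (auto simp: E_def)
      have "{p x, p y, p t} \<subseteq> {b. {x, b} \<in> edges G \<and> {y, b} \<in> edges G}"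
        using xy xt yt A pE by (auto simp: E_def)
      moreover have "finite {b. {x, b} \<in> edges G \<and> {y, b} \<in> edges G}"
        by (rule finite_subset[OF _ fin]) (use edge_verts in auto)
      ultimately have "card {p x, p y, p t} \<le> 2"
        using no_K23[OF A(1,2) neq(1)] by (meson card_mono le_trans)
      moreover have "card {p x, p y, p t} = 3"
      proof -
        have "card (p ` {x, y, t}) = card {x, y, t}"
          by (rule card_image, rule inj_on_subset[of p A]) (use p A in \<open>auto simp: bij_betw_def\<close>)
        then show ?thesis
          using neq by simp
      qed
      ultimately show False
        by simp
    qed
  qed
  then obtain T where T: "T \<subseteq> A" "acyclic_on E T" "2 * card A \<le> (d + 2) * card T"
    by blast
  let ?S = "(\<lambda>a. {a, p a}) ` (A - T)"
  have "forcing_set G M ?S"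
    using T unfolding E_def by (intro forcing_set_of_acyclic_on[OF parts bip M p])
  moreover have "finite (edges G)"
    by (rule finite_subset[of _ "Pow (verts G)"]) (use edge_verts fin in auto)
  ultimately have "forcing_number G M \<le> card ?S"
    unfolding forcing_number_def by (intro Min_le finite_forcing_sizes) auto
  also have "\<dots> \<le> card (A - T)"
    using finA by (intro card_image_le) simp
  also have "\<dots> = card A - card T"
    using T finA by (meson card_Diff_subset finite_subset)
  finally have "forcing_number G M + card T \<le> card A"
    using card_mono[OF finA T(1)] by linarith
  then have "(d + 2) * (forcing_number G M + card T) \<le> (d + 2) * card A"
    by (rule mult_le_mono2)
  then have "(d + 2) * forcing_number G M \<le> d * card A"
    using T(3) by (simp add: algebra_simps)
  moreover have "card (verts G) = 2 * card A"
    using parts finA finB bij_betw_same_card[OF p(1)] by (simp add: card_Un_disjoint)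
  ultimately show ?thesis
    by simp
qed

section \<open>Hypercubes\<close>

abbreviation cube :: "nat \<Rightarrow> (nat \<Rightarrow> nat) set" where
  "cube n \<equiv> {..<n} \<rightarrow>\<^sub>E {0, 1}"

definition flip :: "(nat \<Rightarrow> nat) \<Rightarrow> nat \<Rightarrow> nat \<Rightarrow> nat" where
  "flip x i = x(i := 1 - x i)"

lemma verts_hypercube: "verts (hypercube n) = cube n"
  by (simp only: hypercube_def Let_def graph.simps)

lemma hypercube_edgeE:
  assumes "e \<in> edges (hypercube n)"
  obtains x y where "e = {x, y}" "x \<in> cube n" "y \<in> cube n" "card {i \<in> {..<n}. x i \<noteq> y i} = 1"
proof -
  have "\<exists>x y. e = {x, y} \<and> x \<in> cube n \<and> y \<in> cube n \<and> card {i \<in> {..<n}. x i \<noteq> y i} = 1"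
    using assms unfolding hypercube_def Let_def graph.simps by (rule CollectD)
  then show ?thesis
    using that by blast
qed

lemma differ_in_one_eq_flip:
  assumes "x \<in> cube n" "y \<in> cube n" "card {i \<in> {..<n}. x i \<noteq> y i} = 1"
  shows "\<exists>i<n. y = flip x i"
proof -
  obtain i where i: "{i \<in> {..<n}. x i \<noteq> y i} = {i}"
    using assms(3) by (rule card_1_singletonE)
  have "i \<in> {i \<in> {..<n}. x i \<noteq> y i}"
    unfolding i by (rule singletonI)
  then have "i < n"
    by simp
  have "y j = flip x i j" for j
  proof (cases "j < n")
    case True
    then have "x j \<in> {0, 1}" "y j \<in> {0, 1}"
      using assms by (auto simp: PiE_iff)
    moreover have "x j \<noteq> y j \<longleftrightarrow> j = i"
    proof -
      have "j \<in> {i \<in> {..<n}. x i \<noteq> y i} \<longleftrightarrow> j \<in> {i}"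
        by (simp only: i)
      then show ?thesis
        using True by (simp only: mem_Collect_eq lessThan_iff singleton_iff simp_thms)
    qed
    ultimately show ?thesis
      by (auto simp: flip_def)
  next
    case False
    then have "x j = undefined" "y j = undefined"
      by (simp_all add: PiE_arb[OF assms(1)] PiE_arb[OF assms(2)])
    moreover have "j \<noteq> i"
      using False \<open>i < n\<close> by blast
    ultimately show ?thesis
      by (simp add: flip_def)
  qed
  then show ?thesis
    using \<open>i < n\<close> by blast
qed

lemma hypercube_edge_flip:
  assumes "{x, y} \<in> edges (hypercube n)"
  shows "x \<in> cube n \<and> y \<in> cube n \<and> (\<exists>i<n. y = flip x i)"
proof -
  obtain a b where ab: "{x, y} = {a, b}" "a \<in> cube n" "b \<in> cube n"
    "card {i \<in> {..<n}. a i \<noteq> b i} = 1"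
    using assms by (rule hypercube_edgeE)
  have "{i \<in> {..<n}. b i \<noteq> a i} = {i \<in> {..<n}. a i \<noteq> b i}"
    by (rule Collect_cong) (simp only: eq_commute)
  then have "card {i \<in> {..<n}. b i \<noteq> a i} = 1"
    using ab(4) by (simp only:)
  then have "\<exists>i<n. a = flip b i" "\<exists>i<n. b = flip a i"
    using differ_in_one_eq_flip[OF ab(3,2)] differ_in_one_eq_flip[OF ab(2-4)] by blast+
  moreover have "x = a \<and> y = b \<or> x = b \<and> y = a"
    using ab(1) by (simp only: doubleton_eq_iff)
  ultimately show ?thesis
    using ab(2,3) by (elim disjE conjE) (simp_all only: simp_thms)
qed

text \<open>The parity of the coordinate sum is the bipartition of the hypercube.\<close>

lemma even_sum_flip:
  assumes "x \<in> cube n" "i < n"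
  shows "even (sum (flip x i) {..<n}) \<longleftrightarrow> odd (sum x {..<n})"
proof -
  have "sum (flip x i) {..<n} = (1 - x i) + sum x ({..<n} - {i})"
    using assms sum.remove[of "{..<n}" i "flip x i"] by (simp add: flip_def)
  moreover have "sum x {..<n} = x i + sum x ({..<n} - {i})"
    using assms sum.remove[of "{..<n}" i x] by simp
  moreover have "x i = 0 \<or> x i = 1"
    using PiE_mem[OF assms(1), of i] assms(2) by simp
  ultimately show ?thesis
    by (elim disjE) simp_all
qed

lemma hypercube_degree_le: "card {a. {a, b} \<in> edges (hypercube n)} \<le> n"
proof -
  have "{a. {a, b} \<in> edges (hypercube n)} \<subseteq> flip b ` {..<n}"
  proof
    fix a assume "a \<in> {a. {a, b} \<in> edges (hypercube n)}"
    then have "{b, a} \<in> edges (hypercube n)"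
      by (simp add: insert_commute)
    then show "a \<in> flip b ` {..<n}"
      using hypercube_edge_flip by blast
  qed
  then have "card {a. {a, b} \<in> edges (hypercube n)} \<le> card (flip b ` {..<n})"
    by (intro card_mono) auto
  also have "\<dots> \<le> n"
    using card_image_le[of "{..<n}" "flip b"] by simp
  finally show ?thesis .
qed

text \<open>
  A common neighbour arises from \<open>x\<close> by flipping \<open>i\<close> and from \<open>y\<close> by flipping \<open>j\<close>, and then \<open>x\<close>
  and \<open>y\<close> differ exactly in \<open>i\<close> and \<open>j\<close>. So it is determined by the choice of \<open>i\<close> among
  the two coordinates in which \<open>x\<close> and \<open>y\<close> differ.
\<close>

lemma hypercube_common_neighbours_le:
  assumes "x \<noteq> y"
  shows "card {b. {x, b} \<in> edges (hypercube n) \<and> {y, b} \<in> edges (hypercube n)} \<le> 2"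
    (is "card ?N \<le> 2")
proof (cases "?N = {}")
  case False
  define D where "D = {k. x k \<noteq> y k}"
  have D: "\<exists>i j. z = flip x i \<and> D = {i, j}" if "z \<in> ?N" for z
  proof -
    have xz: "{x, z} \<in> edges (hypercube n)" and yz: "{y, z} \<in> edges (hypercube n)"
      using that by simp_all
    obtain i j where z: "i < n" "z = flip x i" "j < n" "z = flip y j" and cube: "x \<in> cube n" "y \<in> cube n"
      using hypercube_edge_flip[OF xz] hypercube_edge_flip[OF yz] by blast
    have bits: "x i \<in> {0, 1}" "x j \<in> {0, 1}" "y i \<in> {0, 1}" "y j \<in> {0, 1}"
      using PiE_mem[OF cube(1)] PiE_mem[OF cube(2)] z(1,3) by simp_all
    have eq: "flip x i k = flip y j k" for k
      by (simp only: z(2)[symmetric] z(4)[symmetric])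
    have off: "x k = y k" if "k \<noteq> i" "k \<noteq> j" for k
      using eq[of k] that by (simp add: flip_def)
    have "i \<noteq> j"
    proof
      assume "i = j"
      then have "x k = y k" for k
        using eq[of k] bits off[of k] by (cases "k = i") (auto simp: flip_def)
      then show False
        using assms by blast
    qed
    then have "x i \<noteq> y i" "x j \<noteq> y j"
      using eq[of i] eq[of j] bits by (auto simp: flip_def)
    then have "D = {i, j}"
      using off by (auto simp: D_def)
    then show ?thesis
      using z by blast
  qed
  obtain i j where "D = {i, j}"
    using D False by blast
  then have cardD: "finite D" "card D \<le> 2"
    by (simp_all add: card_insert_if)
  have "?N \<subseteq> flip x ` D"
    using D by blast
  then have "card ?N \<le> card (flip x ` D)"
    using cardD by (intro card_mono) auto
  also have "\<dots> \<le> 2"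
    using card_image_le[OF cardD(1), of "flip x"] cardD(2) by linarith
  finally show ?thesis .
next
  case True
  then show ?thesis
    by (simp only: card.empty zero_le)
qed

lemma forcing_number_hypercube_le:
  assumes "perfect_matching (hypercube n) M"
  shows "2 * (n + 2) * forcing_number (hypercube n) M \<le> n * 2 ^ n"
proof -
  let ?A = "{x \<in> cube n. even (sum x {..<n})}" and ?B = "{x \<in> cube n. odd (sum x {..<n})}"
  have "2 * (n + 2) * forcing_number (hypercube n) M \<le> n * card (verts (hypercube n))"
  proof (rule forcing_number_bipartite_le[where A = ?A and B = ?B])
    show "finite (verts (hypercube n))"
      unfolding verts_hypercube by (intro finite_PiE) simp_all
    show "verts (hypercube n) = ?A \<union> ?B"
      unfolding verts_hypercube by blast
    show "?A \<inter> ?B = {}"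
      by auto
    fix e assume e: "e \<in> edges (hypercube n)"
    then obtain x y where xy: "e = {x, y}"
      by (rule hypercube_edgeE)
    then obtain i where "x \<in> cube n" "y \<in> cube n" "i < n" "y = flip x i"
      using e hypercube_edge_flip by blast
    then have "x \<in> ?A \<and> y \<in> ?B \<or> y \<in> ?A \<and> x \<in> ?B"
      using even_sum_flip[of x n i] by blast
    moreover have "e = {y, x}"
      unfolding xy by (rule insert_commute)
    ultimately show "\<exists>a\<in>?A. \<exists>b\<in>?B. e = {a, b}"
      using xy by blast
  next
    show "card {a. {a, b} \<in> edges (hypercube n)} \<le> n" for b
      by (rule hypercube_degree_le)
    show "card {b. {x, b} \<in> edges (hypercube n) \<and> {y, b} \<in> edges (hypercube n)} \<le> 2"
      if "x \<noteq> y" for x y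
      using that by (rule hypercube_common_neighbours_le)
  qed (rule assms)
  also have "card (verts (hypercube n)) = 2 ^ n"
    unfolding verts_hypercube by (subst card_PiE) (simp_all add: numeral_2_eq_2)
  finally show ?thesis .
qed

theorem max_forcing_number_hypercube_le:
  assumes "n \<ge> 1"
  shows "2 * (n + 2) * max_forcing_number (hypercube n) \<le> n * 2 ^ n"
proof -
  let ?F = "{forcing_number (hypercube n) M | M. perfect_matching (hypercube n) M}"
  have "finite ?F"
    by (intro finite_forcing_numbers finite_edges_hypercube)
  moreover have "?F \<noteq> {}"
    using ex_perfect_matching_hypercube[OF assms] by blast
  ultimately have "max_forcing_number (hypercube n) \<in> ?F"
    unfolding max_forcing_number_def by (rule Max_in)
  then obtain M where M: "perfect_matching (hypercube n) M"
    and max: "max_forcing_number (hypercube n) = forcing_number (hypercube n) M"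
    by blast
  show ?thesis
    unfolding max using M by (rule forcing_number_hypercube_le)
qed

theorem corollary4p5:
  fixes n :: nat
  assumes "n \<ge> 4"
  shows "int (max_forcing_number (hypercube n))
    \<le> \<lfloor>(real n * 2 ^ (n - 1) - 5 * 2 ^ (n - 3)) / real n\<rfloor>"
proof -
  define F where "F = max_forcing_number (hypercube n)"
  define N :: real where "N = real n"
  define c :: real where "c = 2 ^ (n - 3)"
  have "N \<ge> 4" "c > 0"
    using assms by (simp_all add: N_def c_def)
  have pow: "2 ^ n = 8 * c" "2 ^ (n - 1) = 4 * c"
  proof -
    obtain k where "n = k + 3"
      using assms that[of "n - 3"] by simp
    then show "2 ^ n = 8 * c" "2 ^ (n - 1) = 4 * c"
      by (simp_all add: c_def power_add)
  qed
  have "2 * (n + 2) * F \<le> n * 2 ^ n"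
    using assms unfolding F_def by (intro max_forcing_number_hypercube_le) simp
  then have "real (2 * (n + 2) * F) \<le> real (n * 2 ^ n)"
    by (rule of_nat_mono)
  then have F: "(N + 2) * real F \<le> 4 * N * c"
    using pow by (simp add: N_def algebra_simps)
  have "(N + 2) * (real F * N) \<le> N * (4 * N * c)"
    using mult_left_mono[OF F, of N] \<open>N \<ge> 4\<close> by (simp add: algebra_simps)
  also have "\<dots> \<le> (N + 2) * (N * (4 * c) - 5 * c)"
  proof -
    have "(N + 2) * (N * (4 * c) - 5 * c) - N * (4 * N * c) = (3 * N - 10) * c"
      by (simp add: algebra_simps)
    moreover have "(3 * N - 10) * c \<ge> 0"
      using \<open>N \<ge> 4\<close> \<open>c > 0\<close> by simp
    ultimately show ?thesis
      by linarith
  qed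
  finally have "real F * N \<le> N * (4 * c) - 5 * c"
    using \<open>N \<ge> 4\<close> by (simp add: mult_le_cancel_left)
  then have "real F \<le> (N * (4 * c) - 5 * c) / N"
    using \<open>N \<ge> 4\<close> by (simp add: le_divide_eq)
  then show ?thesis
    using pow by (simp add: F_def N_def c_def le_floor_iff)
qed

end
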